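(* Let $K\subset\mathbb{R}^d$ be compact, and let $k:\mathbb{R}^d\times\mathbb{R}^d\to\mathbb{R}$ be a positive-definite kernel of the form $$k(x,y)=h(x)\,k'(x-y)\,h(y)=\mathbb{E}_{\omega\sim\mathcal{N}(0,I_d)}\big[\phi(\omega,x)^\top\phi(\omega,y)\big],\qquad \phi(\omega,x)=h(x)\,\psi(\omega^\top x),$$ where $h:\mathbb{R}^d\to\mathbb{R}$ is continuous, $k':\mathbb{R}^d\to\mathbb{R}$, and $\psi:\mathbb{R}\to\mathbb{R}^D$. Assume that $\phi:\mathbb{R}^d\times\mathbb{R}^d\to\mathbb{R}^D$ is continuous and that $g(\omega):=\sup_{x\in K}\|\phi(\omega,x)\|^2$ is finite for every $\omega\in\mathbb{R}^d$ and satisfies $\mathbb{E}_{\omega\sim\mathcal{N}(0,I_d)}[g(\omega)]<\infty$. Let $\sigma:\mathbb{R}\to\mathbb{R}$ be a Lipschitz, non-polynomial activation function. Then for every $\epsilon>0$ there exist $M>0$ and one-hidden-layer MLPs $h_{NN}:\mathbb{R}^d\to\mathbb{R}$ and $\psi_{NN}:\mathbb{R}\to\mathbb{R}^D$ with activation $\sigma$ such that, with $$\phi_{NN}(\omega,x):=h_{NN}(x)\,\mathrm{clip}\big(\psi_{NN}(\omega^\top x),[-M,M]\big),\qquad k_{NN}(x,y):=\mathbb{E}_{\omega\sim\mathcal{N}(0,I_d)}\big[\phi_{NN}(\omega,x)\cdot\phi_{NN}(\omega,y)\big],$$ one has $|k(x,y)-k_{NN}(x,y)|\le\epsilon$ for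 all $x,y\in K$.
   Context: A one-hidden-layer MLP $\mathbb{R}^p\to\mathbb{R}^q$ with activation $\sigma$ is a map $z\mapsto A\,\sigma(Wz+b)$ with $w\in\mathbb{N}$, $W\in\mathbb{R}^{w\times p}$, $b\in\mathbb{R}^w$, $A\in\mathbb{R}^{q\times w}$, where $\sigma$ acts componentwise. $\mathrm{clip}(v,[-M,M])$ truncates each component of the vector $v$ to $[-M,M]$. A positive-definite kernel is a symmetric function $k$ with $\sum_{i,j}c_ic_jk(x_i,x_j)\ge0$ for all finite families of reals $c_i$ and points $x_i$. *)

theory Defs
  imports "HOL-Probability.Probability" "HOL-Computational_Algebra.Polynomial"
begin

definition pos_def_kernel :: "('a \<Rightarrow> 'a \<Rightarrow> real) \<Rightarrow> bool" where
  "pos_def_kernel k \<longleftrightarrow>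
     (\<forall>x y. k x y = k y x) \<and>
     (\<forall>(n::nat) (c::nat \<Rightarrow> real) (x::nat \<Rightarrow> 'a).
        0 \<le> (\<Sum>i<n. \<Sum>j<n. c i * c j * k (x i) (x j)))"

(* The law of a random vector whose coordinates are independent standard normals. *)
definition std_gaussian :: "(real ^ 'n) measure" where
  "std_gaussian = density lborel (\<lambda>\<omega>. ennreal (\<Prod>i\<in>UNIV. std_normal_density (\<omega> $ i)))"

lemma sets_std_gaussian [measurable_cong, simp]: "sets std_gaussian = sets borel"
  by (simp add: std_gaussian_def)

lemma space_std_gaussian [simp]: "space std_gaussian = UNIV"
  by (simp add: std_gaussian_def)

lemma std_gaussian_density_eq:
  fixes \<omega> :: "real ^ 'n"
  shows "(\<Prod>i\<in>UNIV. std_normal_density (\<omega> $ i)) =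
         (2 * pi) powr (- real CARD('n) / 2) * exp (- (norm \<omega>)\<^sup>2 / 2)"
proof -
  have c: "(1 / sqrt (2 * pi)) ^ CARD('n) = (2 * pi) powr (- real CARD('n) / 2)"
    by (simp add: powr_half_sqrt [symmetric] powr_realpow [symmetric] powr_powr
        powr_minus_divide power_one_over)
  have n: "(norm \<omega>)\<^sup>2 = (\<Sum>i\<in>UNIV. (\<omega> $ i)\<^sup>2)"
    by (simp add: norm_vec_def L2_set_def sum_nonneg)
  have "(\<Prod>i\<in>UNIV. std_normal_density (\<omega> $ i)) =
        (1 / sqrt (2 * pi)) ^ CARD('n) * exp (\<Sum>i\<in>UNIV. - (\<omega> $ i)\<^sup>2 / 2)"
    by (simp only: std_normal_density_def prod.distrib exp_sum finite prod_constant)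
  then show ?thesis
    by (simp only: c n sum_divide_distrib [symmetric] sum_negf)
qed

lemma prob_space_std_gaussian: "prob_space (std_gaussian :: (real ^ 'n) measure)"
proof
  let ?f = "\<lambda>x. ennreal (std_normal_density x)"
  have bij: "bij_betw (\<lambda>i. axis i (1::real)) (UNIV :: 'n set) (Basis :: (real ^ 'n) set)"
    by (auto simp: bij_betw_def inj_on_def axis_eq_axis Basis_vec_def)
  have one: "(\<integral>\<^sup>+x. ?f x \<partial>lborel) = 1"
    using prob_space.emeasure_space_1 [OF prob_space_normal_density [of 1 0]]
    by (simp add: emeasure_density)
  have "emeasure (std_gaussian :: (real ^ 'n) measure) (space std_gaussian) =
        (\<integral>\<^sup>+\<omega>. (\<Prod>i\<in>UNIV. ?f (\<omega> $ i)) \<partial>(lborel :: (real ^ 'n) measure))"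
    by (simp add: std_gaussian_def emeasure_density prod_ennreal)
  also have "\<dots> = (\<integral>\<^sup>+\<omega>. (\<Prod>b\<in>Basis. ?f (\<omega> \<bullet> b)) \<partial>(lborel :: (real ^ 'n) measure))"
    by (intro nn_integral_cong)
       (simp add: prod.reindex_bij_betw [OF bij, symmetric] inner_axis)
  also have "\<dots> = (\<Prod>b\<in>(Basis :: (real ^ 'n) set). \<integral>\<^sup>+x. ?f x \<partial>lborel)"
    by (intro nn_integral_lborel_prod) auto
  finally show "emeasure (std_gaussian :: (real ^ 'n) measure) (space std_gaussian) = 1"
    by (simp add: one)
qed

(* A \<sigma>(W z + b) with hidden width w: W i is the i-th row of W and A i the i-th column of A.
   Inputs and outputs range over Euclidean spaces, so that real itself serves as the
   one-dimensional space. *)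
definition is_mlp :: "(real \<Rightarrow> real) \<Rightarrow> ('a::euclidean_space \<Rightarrow> 'b::euclidean_space) \<Rightarrow> bool" where
  "is_mlp \<sigma> f \<longleftrightarrow>
     (\<exists>(w::nat) (W::nat \<Rightarrow> 'a) (b::nat \<Rightarrow> real) (A::nat \<Rightarrow> 'b).
        f = (\<lambda>z. \<Sum>i<w. \<sigma> (W i \<bullet> z + b i) *\<^sub>R A i))"

definition clip :: "real \<Rightarrow> real ^ 'n \<Rightarrow> real ^ 'n" where
  "clip M v = clamp (vec (- M)) (vec M) v"

lemma clip_nth:
  assumes "0 \<le> M"
  shows "clip M v $ i = max (- M) (min M (v $ i))"
proof -
  have le: "\<forall>b\<in>Basis. vec (- M) \<bullet> b \<le> (vec M :: real ^ 'a) \<bullet> b"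
    using assms by (auto simp: Basis_vec_def inner_axis)
  have ax: "axis i (1::real) \<in> Basis"
    by (simp add: axis_in_Basis_iff)
  have "clip M v \<bullet> axis i 1 = max (- M) (min M (v \<bullet> axis i 1))"
    using assms le
    by (simp add: clip_def clamp_def ax) (simp add: inner_axis)
  then show ?thesis
    by (simp add: inner_axis)
qed

end

theory Submission
  imports Defs
begin

text \<open>
  Universal approximation: if all differences of order \<open>i\<close> of the continuous \<open>\<sigma>\<close> vanished,
  then \<open>\<sigma>\<close> would be a polynomial. For a linear form \<open>u\<close>, each \<open>u\<^sup>i \<cdot> f (s u + b)\<close> in the uniform
  closure of the networks puts \<open>u\<^sup>i\<^sup>+\<^sup>1 \<cdot> (f (s u + b + \<delta>) - f (s u + b))\<close> there as well, because the
  latter is the \<open>s\<close>-derivative of \<open>u\<^sup>i \<cdot> J (s u + b)\<close>, where \<open>J x\<close>, the integral of \<open>f\<close> over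
  \<open>[x, x + \<delta>]\<close>, is a limit of Riemann sums. At \<open>s = 0\<close> this yields the powers \<open>u\<^sup>i\<close>, hence \<open>exp u\<close>,
  and the sums of such exponentials form an algebra to which Stone--Weierstrass applies.

  Kernel approximation: clipping never increases the norm of the features, so a radius \<open>R\<close> that makes the
  tail of \<open>g\<close> small can be chosen before \<open>M\<close>, which bounds \<open>\<psi>\<close> on the arguments reached from
  \<open>norm \<omega> \<le> R\<close>. With \<open>M\<close> fixed the network features are bounded, and a second radius \<open>R'\<close> makes
  their tail small; the networks need to be accurate only for \<open>norm \<omega> \<le> R'\<close>.
\<close>

section \<open>Algebraic closure properties of networks\<close>

lemma is_mlp_neuron: "is_mlp \<sigma> (\<lambda>z. \<sigma> (v \<bullet> z + b))"
  unfolding is_mlp_def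
  by (rule exI[of _ 1], rule exI[of _ "\<lambda>_. v"], rule exI[of _ "\<lambda>_. b"], rule exI[of _ "\<lambda>_. 1"]) simp

lemma is_mlp_zero: "is_mlp \<sigma> (\<lambda>z. 0)"
  unfolding is_mlp_def by (rule exI[of _ 0]) simp

lemma is_mlp_add:
  assumes "is_mlp \<sigma> f" and "is_mlp \<sigma> g"
  shows "is_mlp \<sigma> (\<lambda>z. f z + g z)"
proof -
  obtain m :: nat and W b A where f: "f = (\<lambda>z. \<Sum>i<m. \<sigma> (W i \<bullet> z + b i) *\<^sub>R A i)"
    using assms(1) unfolding is_mlp_def by blast
  obtain n :: nat and V c B where g: "g = (\<lambda>z. \<Sum>i<n. \<sigma> (V i \<bullet> z + c i) *\<^sub>R B i)"
    using assms(2) unfolding is_mlp_def by blast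
  have split: "(\<Sum>i<m + n. t i) = (\<Sum>i<m. t i) + (\<Sum>i<n. t (m + i))" for t :: "nat \<Rightarrow> 'b"
    by (induction n) (simp_all add: add.assoc)
  show ?thesis
    unfolding is_mlp_def
  proof (intro exI)
    show "(\<lambda>z. f z + g z) = (\<lambda>z. \<Sum>i<m + n. \<sigma> ((if i < m then W i else V (i - m)) \<bullet> z +
        (if i < m then b i else c (i - m))) *\<^sub>R (if i < m then A i else B (i - m)))"
      by (simp add: f g split)
  qed
qed

lemma is_mlp_linear_image:
  assumes "linear l" and "is_mlp \<sigma> f"
  shows "is_mlp \<sigma> (\<lambda>z. l (f z))"
proof -
  obtain m :: nat and W b A where f: "f = (\<lambda>z. \<Sum>i<m. \<sigma> (W i \<bullet> z + b i) *\<^sub>R A i)"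
    using assms(2) unfolding is_mlp_def by blast
  show ?thesis
    unfolding is_mlp_def
    by (rule exI[of _ m], rule exI[of _ W], rule exI[of _ b], rule exI[of _ "\<lambda>i. l (A i)"])
      (simp add: f linear_sum[OF assms(1)] linear_cmul[OF assms(1)])
qed

lemma continuous_is_mlp:
  assumes "continuous_on UNIV \<sigma>" and "is_mlp \<sigma> f"
  shows "continuous_on UNIV f"
proof -
  obtain m :: nat and W b A where f: "f = (\<lambda>z. \<Sum>i<m. \<sigma> (W i \<bullet> z + b i) *\<^sub>R A i)"
    using assms(2) unfolding is_mlp_def by blast
  show ?thesis
    unfolding f
    by (intro continuous_intros continuous_on_compose2[OF assms(1)]) auto
qed

section \<open>The uniform closure of the networks on a set\<close>

definition mlp_approx ::
    "(real \<Rightarrow> real) \<Rightarrow> 'a set \<Rightarrow> ('a::euclidean_space \<Rightarrow> 'b::euclidean_space) \<Rightarrow> bool" where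
  "mlp_approx \<sigma> K f \<longleftrightarrow> (\<forall>e>0. \<exists>N. is_mlp \<sigma> N \<and> (\<forall>z\<in>K. norm (f z - N z) \<le> e))"

lemma mlp_approx_is_mlp: "is_mlp \<sigma> f \<Longrightarrow> mlp_approx \<sigma> K f"
  unfolding mlp_approx_def by (auto intro!: exI[of _ f])

text \<open>The closure is itself closed, by splitting the error in half. Later limits can thus be
  taken among approximable functions, without returning to networks.\<close>

lemma mlp_approx_limit:
  assumes "\<And>e. 0 < e \<Longrightarrow> \<exists>g. mlp_approx \<sigma> K g \<and> (\<forall>z\<in>K. norm (f z - g z) \<le> e)"
  shows "mlp_approx \<sigma> K f"
  unfolding mlp_approx_def
proof (intro allI impI)
  fix e :: real assume "0 < e"
  then obtain g where g: "mlp_approx \<sigma> K g" "\<forall>z\<in>K. norm (f z - g z) \<le> e / 2"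
    using assms[of "e / 2"] by auto
  then obtain N where N: "is_mlp \<sigma> N" "\<forall>z\<in>K. norm (g z - N z) \<le> e / 2"
    using \<open>0 < e\<close> unfolding mlp_approx_def by (meson half_gt_zero)
  have "norm (f z - N z) \<le> e" if "z \<in> K" for z
    using norm_triangle_ineq[of "f z - g z" "g z - N z"] g(2) N(2) that by force
  with N(1) show "\<exists>N. is_mlp \<sigma> N \<and> (\<forall>z\<in>K. norm (f z - N z) \<le> e)" by blast
qed

lemma mlp_approx_add:
  assumes "mlp_approx \<sigma> K f" and "mlp_approx \<sigma> K g"
  shows "mlp_approx \<sigma> K (\<lambda>z. f z + g z)"
  unfolding mlp_approx_def
proof (intro allI impI)
  fix e :: real assume "0 < e"
  then obtain N P where N: "is_mlp \<sigma> N" "\<forall>z\<in>K. norm (f z - N z) \<le> e / 2"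
    and P: "is_mlp \<sigma> P" "\<forall>z\<in>K. norm (g z - P z) \<le> e / 2"
    using assms unfolding mlp_approx_def by (meson half_gt_zero)
  have "norm ((f z + g z) - (N z + P z)) \<le> e" if "z \<in> K" for z
    using norm_triangle_ineq[of "f z - N z" "g z - P z"] N(2) P(2) that
    by (force simp: algebra_simps)
  with is_mlp_add[OF N(1) P(1)]
  show "\<exists>N. is_mlp \<sigma> N \<and> (\<forall>z\<in>K. norm ((f z + g z) - N z) \<le> e)" by blast
qed

text \<open>A linear map between Euclidean spaces is Lipschitz, and applying it to a network only
  changes the output weights. This serves for scalar multiples and for placing a scalar network
  along a basis vector.\<close>

lemma mlp_approx_linear_image:
  assumes "linear l" and "mlp_approx \<sigma> K f"
  shows "mlp_approx \<sigma> K (\<lambda>z. l (f z))"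
  unfolding mlp_approx_def
proof (intro allI impI)
  fix e :: real assume "0 < e"
  obtain B where B: "0 < B" "\<And>x. norm (l x) \<le> B * norm x"
    using linear_bounded_pos[OF assms(1)] by blast
  obtain N where N: "is_mlp \<sigma> N" "\<forall>z\<in>K. norm (f z - N z) \<le> e / B"
    using assms(2) \<open>0 < e\<close> B(1) unfolding mlp_approx_def by (meson divide_pos_pos)
  have "norm (l (f z) - l (N z)) \<le> e" if "z \<in> K" for z
  proof -
    have "norm (l (f z) - l (N z)) \<le> B * norm (f z - N z)"
      using B(2)[of "f z - N z"] by (simp add: linear_diff[OF assms(1)])
    also have "\<dots> \<le> B * (e / B)" using N(2) that B(1) by (intro mult_left_mono) auto
    finally show ?thesis using B(1) by simp
  qed
  with is_mlp_linear_image[OF assms(1) N(1)]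
  show "\<exists>N. is_mlp \<sigma> N \<and> (\<forall>z\<in>K. norm (l (f z) - N z) \<le> e)" by blast
qed

lemma mlp_approx_cmult:
  fixes f :: "'a::euclidean_space \<Rightarrow> real"
  assumes "mlp_approx \<sigma> K f"
  shows "mlp_approx \<sigma> K (\<lambda>z. c * f z)"
  by (rule mlp_approx_linear_image[OF _ assms]) (simp add: linear_times)

lemma mlp_approx_sum:
  assumes "\<And>i. i \<in> I \<Longrightarrow> mlp_approx \<sigma> K (f i)"
  shows "mlp_approx \<sigma> K (\<lambda>z. \<Sum>i\<in>I. f i z)"
  using assms
  by (induction I rule: infinite_finite_induct)
    (auto intro!: mlp_approx_add mlp_approx_is_mlp[OF is_mlp_zero])

section \<open>Finite differences and Frechet's characterization of polynomials\<close>

definition fdiff :: "real \<Rightarrow> (real \<Rightarrow> real) \<Rightarrow> real \<Rightarrow> real" where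
  "fdiff \<delta> f x = f (x + \<delta>) - f x"

text \<open>The shift by \<open>\<delta>\<close> is the identity plus \<open>fdiff \<delta>\<close>,
  so its \<open>m\<close>-th power expands binomially, and the terms of order \<open>k\<close> and
  above vanish. The induction keeps \<open>f\<close> arbitrary because its step needs the claim for
  \<open>fdiff \<delta> f\<close> too.\<close>

lemma newton_forward_difference:
  assumes "\<And>x. (fdiff \<delta> ^^ k) f x = 0"
  shows "f (a + real m * \<delta>) = (\<Sum>i<k. real (m choose i) * (fdiff \<delta> ^^ i) f a)"
  using assms
proof (induction m arbitrary: f)
  case 0
  show ?case
  proof (cases k)
    case (Suc k')
    then show ?thesis by (simp add: sum.lessThan_Suc_shift del: sum.lessThan_Suc)
  qed (use 0 in simp)
next
  case (Suc m)
  show ?case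
  proof (cases k)
    case 0
    then show ?thesis using Suc.prems by simp
  next
    case (Suc k')
    have pow: "(fdiff \<delta> ^^ i) (fdiff \<delta> f) = (fdiff \<delta> ^^ Suc i) f" for i
      by (simp only: funpow_Suc_right o_def)
    have "(fdiff \<delta> ^^ k) (fdiff \<delta> f) x = 0" for x
      unfolding pow by (simp add: fdiff_def Suc.prems)
    from Suc.IH[OF this]
    have 1: "fdiff \<delta> f (a + real m * \<delta>)
        = (\<Sum>i<k. real (m choose i) * (fdiff \<delta> ^^ Suc i) f a)" unfolding pow .
    \<comment> \<open>The last term contains the vanishing \<open>k\<close>-th difference. Without
      it the index range matches that of \<open>3\<close>, and Pascal's rule merges the two
      sums.\<close>
    also have "\<dots> = (\<Sum>i<k'. real (m choose i) * (fdiff \<delta> ^^ Suc i) f a)"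
      using Suc.prems[of a] by (simp only: \<open>k = Suc k'\<close> sum.lessThan_Suc)
    finally have 2: "fdiff \<delta> f (a + real m * \<delta>)
        = (\<Sum>i<k'. real (m choose i) * (fdiff \<delta> ^^ Suc i) f a)" .
    have 3: "f (a + real m * \<delta>) = f a + (\<Sum>i<k'. real (m choose Suc i) * (fdiff \<delta> ^^ Suc i) f a)"
      using Suc.IH[OF Suc.prems] \<open>k = Suc k'\<close>
      by (simp add: sum.lessThan_Suc_shift del: sum.lessThan_Suc funpow.simps(2))
    have "f (a + real (Suc m) * \<delta>) = f (a + real m * \<delta>) + fdiff \<delta> f (a + real m * \<delta>)"
      by (simp add: fdiff_def algebra_simps)
    also have "\<dots> = f a + (\<Sum>i<k'. real (Suc m choose Suc i) * (fdiff \<delta> ^^ Suc i) f a)"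
      unfolding 2 3 by (simp add: sum.distrib distrib_right del: funpow.simps)
    also have "\<dots> = (\<Sum>i<k. real (Suc m choose i) * (fdiff \<delta> ^^ i) f a)"
      unfolding \<open>k = Suc k'\<close> sum.lessThan_Suc_shift by simp
    finally show ?thesis .
  qed
qed

lemma poly_eq_if_infinite:
  fixes p q :: "real poly"
  assumes "infinite X" and "\<And>x. x \<in> X \<Longrightarrow> poly p x = poly q x"
  shows "p = q"
proof (rule ccontr)
  assume "p \<noteq> q"
  then have "finite {x. poly (p - q) x = 0}" by (intro poly_roots_finite) simp
  moreover have "X \<subseteq> {x. poly (p - q) x = 0}" using assms(2) by auto
  ultimately show False using assms(1) finite_subset by blast
qed

text \<open>In Newton's formula \<open>m choose i\<close> is the polynomial \<open>B i\<close> in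
  \<open>m\<close>, and \<open>m\<close> equals \<open>(x - a) / \<delta>\<close> at the grid point
  \<open>x\<close>. The resulting polynomial may still depend on \<open>a\<close> and
  \<open>\<delta>\<close>.\<close>

lemma poly_on_grid:
  assumes "\<And>x. (fdiff \<delta> ^^ k) f x = 0" and "\<delta> \<noteq> 0"
  obtains p where "\<And>m. f (a + real m * \<delta>) = poly p (a + real m * \<delta>)"
proof
  define B :: "nat \<Rightarrow> real poly" where "B i = smult (1 / fact i) (\<Prod>j=0..<i. [: - real j, 1:])" for i
  have B: "poly (B i) (real m) = real (m choose i)" for i m
    by (simp add: B_def poly_prod binomial_gbinomial gbinomial_prod_rev)
  define p where "p = pcompose (\<Sum>i<k. smult ((fdiff \<delta> ^^ i) f a) (B i)) [: - a / \<delta>, 1 / \<delta> :]"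
  show "f (a + real m * \<delta>) = poly p (a + real m * \<delta>)" for m
    using assms(2) unfolding newton_forward_difference[OF assms(1)]
    by (simp add: p_def poly_pcompose poly_sum add_divide_distrib B mult.commute)
qed

text \<open>The grids from \<open>a\<close> with steps \<open>1 / n\<close> all contain the points
  \<open>a + m\<close>, so their polynomials coincide; together the grids are dense in the half-line
  from \<open>a\<close>, and continuity extends the identity to it. Overlapping half-lines then
  share one polynomial.\<close>

lemma Frechet_polynomial:
  assumes "continuous_on UNIV f" and zero: "\<And>\<delta> x. (fdiff \<delta> ^^ k) f x = 0"
  obtains p where "\<And>x. f x = poly p x"
proof -
  have half_line: "\<exists>p. \<forall>x\<ge>a. f x = poly p x" for a
  proof -
    have "\<exists>p. \<forall>m. f (a + real m * (1 / real n)) = poly p (a + real m * (1 / real n))"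
      if "n > 0" for n :: nat
      using poly_on_grid[OF zero, of "1 / real n" a] that by (metis divide_eq_0_iff of_nat_0_eq_iff
          less_irrefl one_neq_zero)
    then obtain P where P: "f (a + real m * (1 / real n)) = poly (P n) (a + real m * (1 / real n))"
      if "n > 0" for n m :: nat
      by metis
    have P1: "P n = P 1" if "n > 0" for n
    proof (rule poly_eq_if_infinite)
      show "infinite (range (\<lambda>m::nat. a + real m))"
        by (rule range_inj_infinite) (simp add: inj_on_def)
      fix x assume "x \<in> range (\<lambda>m::nat. a + real m)"
      then obtain m where x: "x = a + real m" by blast
      show "poly (P n) x = poly (P 1) x"
        \<comment> \<open>Point \<open>m\<close> of the unit grid is point \<open>m * n\<close> of
          the grid with step \<open>1 / n\<close>.\<close>
        using P[OF that, of "m * n"] P[of 1 m] that by (simp add: x)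
    qed
    have "f x = poly (P 1) x" if "x \<ge> a" for x
    proof -
      \<comment> \<open>The grid point of step \<open>1 / Suc n\<close> at or just below
        \<open>x\<close>. The conversion to \<open>nat\<close> loses nothing because
        \<open>x \<ge> a\<close>.\<close>
      define s where "s n = a + real (nat \<lfloor>real (Suc n) * (x - a)\<rfloor>) * (1 / real (Suc n))" for n
      have floor: "real (nat \<lfloor>real (Suc n) * (x - a)\<rfloor>) = of_int \<lfloor>real (Suc n) * (x - a)\<rfloor>" for n
        using that by simp
      have "\<bar>s n - x\<bar> \<le> 1 / real (Suc n)" for n
      proof -
        have "\<bar>s n - x\<bar> = \<bar>of_int \<lfloor>real (Suc n) * (x - a)\<rfloor> - real (Suc n) * (x - a)\<bar> / real (Suc n)"
        proof -
          have "s n - x = (of_int \<lfloor>real (Suc n) * (x - a)\<rfloor> - real (Suc n) * (x - a)) / real (Suc n)"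
            unfolding s_def floor by (simp add: diff_divide_distrib)
          then show ?thesis by simp
        qed
        also have "\<dots> \<le> 1 / real (Suc n)" by (intro divide_right_mono) linarith+
        finally show ?thesis .
      qed
      then have "(\<lambda>n. s n - x) \<longlonglongrightarrow> 0"
        by (intro Lim_null_comparison[OF _ LIMSEQ_inverse_real_of_nat])
          (auto simp: inverse_eq_divide)
      then have s: "s \<longlonglongrightarrow> x" by (simp add: LIM_zero_iff)
      have "(\<lambda>n. f (s n)) \<longlonglongrightarrow> f x"
        using assms(1) s by (metis UNIV_I continuous_on_eq_continuous_at isCont_tendsto_compose open_UNIV)
      moreover have "(\<lambda>n. poly (P 1) (s n)) \<longlonglongrightarrow> poly (P 1) x"
        using s by (intro tendsto_poly)
      moreover have "f (s n) = poly (P 1) (s n)" for n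
        unfolding s_def using P[of "Suc n"] P1[of "Suc n"] by (metis zero_less_Suc)
      ultimately show ?thesis by (simp add: LIMSEQ_unique)
    qed
    then show ?thesis by blast
  qed
  then obtain Q where Q: "\<And>a x. x \<ge> a \<Longrightarrow> f x = poly (Q a) x" by metis
  have "Q a = Q 0" for a
  proof (rule poly_eq_if_infinite)
    \<comment> \<open>Both polynomials agree with \<open>f\<close> where the two half-lines
      overlap.\<close>
    show "infinite {max a 0..}" by (rule infinite_Ici)
    show "poly (Q a) x = poly (Q 0) x" if "x \<in> {max a 0..}" for x
      using Q[of a x] Q[of 0 x] that by simp
  qed
  then have "f x = poly (Q 0) x" for x using Q[of x x] by (metis order_refl)
  then show ?thesis by (rule that)
qed

section \<open>Powers of linear forms from differences of the activation\<close>

lemma mlp_approx_sup_limit: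
  fixes f :: "'a::euclidean_space \<Rightarrow> real"
  assumes "0 \<le> C" and "\<And>\<eta>. 0 < \<eta> \<Longrightarrow> mlp_approx \<sigma> K (g \<eta>)"
    and "\<And>\<eta> z. 0 < \<eta> \<Longrightarrow> z \<in> K \<Longrightarrow> \<bar>f z - g \<eta> z\<bar> \<le> C * \<eta>"
  shows "mlp_approx \<sigma> K f"
proof (rule mlp_approx_limit)
  fix e :: real assume "0 < e"
  \<comment> \<open>The summand 1 covers the case \<open>C = 0\<close>.\<close>
  define \<eta> where "\<eta> = e / (C + 1)"
  have "0 < \<eta>" using \<open>0 < e\<close> assms(1) by (simp add: \<eta>_def)
  moreover have "C * \<eta> \<le> e" using \<open>0 < e\<close> assms(1) by (simp add: \<eta>_def field_simps)
  ultimately show "\<exists>g. mlp_approx \<sigma> K g \<and> (\<forall>z\<in>K. norm (f z - g z) \<le> e)"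
    using assms(2)[of \<eta>] assms(3)[of \<eta>] by (intro exI[of _ "g \<eta>"]) force
qed

text \<open>By the mean value theorem the increment of \<open>F\<close> is \<open>h * f z\<close>
  with \<open>z\<close> within \<open>\<bar>h\<bar>\<close> of \<open>x\<close>; the Lipschitz bound
  compares \<open>f z\<close> with \<open>f x\<close>.\<close>

lemma antiderivative_first_order:
  fixes f F :: "real \<Rightarrow> real"
  assumes F: "\<And>x. (F has_real_derivative f x) (at x)"
    and L: "\<And>x y. \<bar>f x - f y\<bar> \<le> L * \<bar>x - y\<bar>"
  shows "\<bar>F (x + h) - F x - h * f x\<bar> \<le> L * h\<^sup>2"
proof -
  have L0: "0 \<le> L" using order_trans[OF abs_ge_zero L[of 1 0]] by simp
  consider "h = 0" | "h > 0" | "h < 0" by linarith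
  then obtain z where z: "\<bar>z - x\<bar> \<le> \<bar>h\<bar>" "F (x + h) - F x = h * f z"
  proof cases
    case 1
    then show ?thesis by (intro that[of x]) auto
  next
    case 2
    then obtain z where "x < z" "z < x + h" "F (x + h) - F x = (x + h - x) * f z"
      using MVT2[of x "x + h" F f] F by auto
    then show ?thesis by (intro that[of z]) auto
  next
    case 3
    then obtain z where "x + h < z" "z < x" "F x - F (x + h) = (x - (x + h)) * f z"
      using MVT2[of "x + h" x F f] F by auto
    then show ?thesis by (intro that[of z]) (auto simp: algebra_simps)
  qed
  have "\<bar>F (x + h) - F x - h * f x\<bar> = \<bar>h\<bar> * \<bar>f z - f x\<bar>"
    unfolding z(2) by (simp add: right_diff_distrib flip: abs_mult)
  also have "\<dots> \<le> \<bar>h\<bar> * (L * \<bar>h\<bar>)"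
    using L[of z x] z(1) L0 by (intro mult_left_mono) (auto intro: order_trans mult_left_mono)
  finally show ?thesis by (simp add: power2_eq_square algebra_simps)
qed

text \<open>The increments of \<open>F\<close> telescope, leaving \<open>n\<close> first-order
  errors. With \<open>real n * h\<close> held at \<open>\<delta>\<close> the bound is
  \<open>L * \<delta>\<^sup>2 / n\<close>, which tends to 0.\<close>

lemma riemann_sum_antiderivative:
  fixes f F :: "real \<Rightarrow> real"
  assumes F: "\<And>x. (F has_real_derivative f x) (at x)"
    and L: "\<And>x y. \<bar>f x - f y\<bar> \<le> L * \<bar>x - y\<bar>"
  shows "\<bar>F (x + real n * h) - F x - (\<Sum>i<n. h * f (x + real i * h))\<bar> \<le> real n * (L * h\<^sup>2)"
proof (induction n)
  case (Suc n)
  have eq: "x + real (Suc n) * h = (x + real n * h) + h" by (simp add: algebra_simps)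
  show ?case
    unfolding eq using Suc antiderivative_first_order[OF F L, of "x + real n * h" h]
    by (simp add: algebra_simps)
qed simp

text \<open>Integrating \<open>f\<close> over a window of length \<open>\<delta>\<close> gives a
  function \<open>J\<close> with derivative \<open>fdiff \<delta> f\<close>, so the scale
  \<open>s\<close> can be differentiated although \<open>f\<close> is merely Lipschitz. The
  derivative brings down one factor \<open>u z\<close>.\<close>

lemma mlp_approx_fdiff:
  fixes u :: "'a::euclidean_space \<Rightarrow> real" and f :: "real \<Rightarrow> real"
  assumes L: "\<And>x y. \<bar>f x - f y\<bar> \<le> L * \<bar>x - y\<bar>"
    and B: "\<And>z. z \<in> K \<Longrightarrow> \<bar>u z\<bar> \<le> B" "0 \<le> B"
    and app: "\<And>s b. mlp_approx \<sigma> K (\<lambda>z. u z ^ i * f (s * u z + b))"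
  shows "mlp_approx \<sigma> K (\<lambda>z. u z ^ Suc i * fdiff \<delta> f (s * u z + b))"
proof -
  have L0: "0 \<le> L" using order_trans[OF abs_ge_zero L[of 1 0]] by simp
  have "isCont f x" for x
  proof -
    have "L-lipschitz_on UNIV f" using L L0 by (intro lipschitz_onI) (auto simp: dist_real_def)
    then show ?thesis
      using lipschitz_on_continuous_on continuous_on_eq_continuous_at by blast
  qed
  then obtain F where F: "\<And>x. (F has_real_derivative f x) (at x)"
    using einterval_antiderivative[of "-\<infinity>" "\<infinity>" f]
    by (auto simp: has_real_derivative_iff_has_vector_derivative)
  define J where "J x = F (x + \<delta>) - F x" for x
  have ui: "\<bar>u z ^ i\<bar> \<le> B ^ i" if "z \<in> K" for z
    unfolding power_abs using B that by (intro power_mono) auto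
  have J: "mlp_approx \<sigma> K (\<lambda>z. u z ^ i * J (s * u z + b))" for s b
  proof (rule mlp_approx_limit)
    fix e :: real assume "0 < e"
    define C where "C = B ^ i * (L * \<delta>\<^sup>2)"
    have "0 \<le> C" using B(2) L0 by (simp add: C_def)
    \<comment> \<open>Makes the Riemann sum error \<open>C / n\<close> at most
      \<open>e\<close>.\<close>
    obtain n :: nat where n: "C / e < real n" using reals_Archimedean2 by blast
    have n0: "0 < real n" using n \<open>0 \<le> C\<close> \<open>0 < e\<close> by (meson divide_nonneg_pos le_less_trans)
    define h where "h = \<delta> / real n"
    have h: "real n * h = \<delta>" using n0 by (simp add: h_def)
    \<comment> \<open>The shift \<open>j * h\<close> is absorbed into the bias, so
      \<open>app\<close> covers every summand.\<close>
    define g where "g z = (\<Sum>j<n. h * (u z ^ i * f (s * u z + (b + real j * h))))" for z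
    have "\<bar>u z ^ i * J (s * u z + b) - g z\<bar> \<le> e" if "z \<in> K" for z
    proof -
      let ?x = "s * u z + b"
      have "u z ^ i * J ?x - g z = u z ^ i * (J ?x - (\<Sum>j<n. h * f (?x + real j * h)))"
        by (simp add: g_def right_diff_distrib sum_distrib_left mult_ac add_ac)
      then have "\<bar>u z ^ i * J ?x - g z\<bar> = \<bar>u z ^ i\<bar> * \<bar>J ?x - (\<Sum>j<n. h * f (?x + real j * h))\<bar>"
        by (simp add: abs_mult)
      also have "\<dots> \<le> B ^ i * (real n * (L * h\<^sup>2))"
        using riemann_sum_antiderivative[OF F L, of ?x n h] ui[OF that] B(2)
        by (intro mult_mono) (auto simp: J_def h)
      also have "\<dots> = C / real n"
        using n0 by (simp add: C_def h_def power2_eq_square)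
      also have "\<dots> \<le> e" using n n0 \<open>0 < e\<close> by (simp add: field_simps)
      finally show ?thesis .
    qed
    moreover have "mlp_approx \<sigma> K g"
      unfolding g_def by (intro mlp_approx_sum mlp_approx_cmult app)
    ultimately show "\<exists>g. mlp_approx \<sigma> K g \<and> (\<forall>z\<in>K. norm (u z ^ i * J (s * u z + b) - g z) \<le> e)"
      by (intro exI[of _ g]) simp
  qed
  show ?thesis
  proof (rule mlp_approx_sup_limit)
    show "0 \<le> B ^ i * (2 * L * B\<^sup>2)" using B(2) L0 by simp
    \<comment> \<open>The difference quotient in \<open>s\<close>, written with sums and multiples
      of approximable functions only.\<close>
    let ?g = "\<lambda>\<eta> z. 1 / \<eta> * (u z ^ i * J ((s + \<eta>) * u z + b) + (- 1) * (u z ^ i * J (s * u z + b)))"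
    show "mlp_approx \<sigma> K (?g \<eta>)" for \<eta>
      by (intro mlp_approx_add mlp_approx_cmult J)
    fix \<eta> :: real and z assume "0 < \<eta>" "z \<in> K"
    let ?x = "s * u z + b" and ?k = "\<eta> * u z"
    have x: "(s + \<eta>) * u z + b = ?x + ?k" by (simp add: algebra_simps)
    have k2: "?k\<^sup>2 \<le> (\<eta> * B)\<^sup>2"
      using B(1)[OF \<open>z \<in> K\<close>] \<open>0 < \<eta>\<close> B(2) by (simp add: power_mult_distrib abs_le_square_iff[symmetric])
    \<comment> \<open>Two first-order remainders of \<open>F\<close>, one at each end of the
      window.\<close>
    have "\<bar>?k * fdiff \<delta> f ?x - (J (?x + ?k) - J ?x)\<bar>
        \<le> \<bar>F (?x + \<delta> + ?k) - F (?x + \<delta>) - ?k * f (?x + \<delta>)\<bar> + \<bar>F (?x + ?k) - F ?x - ?k * f ?x\<bar>"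
      by (simp add: J_def fdiff_def right_diff_distrib add_ac)
    also have "\<dots> \<le> L * ?k\<^sup>2 + L * ?k\<^sup>2"
      by (intro add_mono antiderivative_first_order[OF F L])
    also have "\<dots> \<le> 2 * L * (\<eta> * B)\<^sup>2"
      using mult_left_mono[OF k2 L0] by simp
    finally have 1: "\<bar>?k * fdiff \<delta> f ?x - (J (?x + ?k) - J ?x)\<bar> \<le> 2 * L * (\<eta> * B)\<^sup>2" .
    have "u z ^ Suc i * fdiff \<delta> f ?x - ?g \<eta> z
        = u z ^ i / \<eta> * (?k * fdiff \<delta> f ?x - (J (?x + ?k) - J ?x))"
      unfolding x using \<open>0 < \<eta>\<close> by (simp add: field_simps)
    then have "\<bar>u z ^ Suc i * fdiff \<delta> f ?x - ?g \<eta> z\<bar>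
        = \<bar>u z ^ i\<bar> / \<eta> * \<bar>?k * fdiff \<delta> f ?x - (J (?x + ?k) - J ?x)\<bar>"
      using \<open>0 < \<eta>\<close> by (simp add: abs_mult)
    also have "\<dots> \<le> B ^ i / \<eta> * (2 * L * (\<eta> * B)\<^sup>2)"
      using 1 ui[OF \<open>z \<in> K\<close>] \<open>0 < \<eta>\<close> B(2) L0
      by (intro mult_mono divide_right_mono) auto
    also have "\<dots> = B ^ i * (2 * L * B\<^sup>2) * \<eta>"
      using \<open>0 < \<eta>\<close> by (simp add: field_simps power2_eq_square)
    finally show "\<bar>u z ^ Suc i * fdiff \<delta> f ?x - ?g \<eta> z\<bar> \<le> B ^ i * (2 * L * B\<^sup>2) * \<eta>" .
  qed
qed

text \<open>Keeps the Lipschitz hypothesis alive, so that \<open>mlp_approx_fdiff\<close> can be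
  iterated; the constant may double each time.\<close>

lemma fdiff_lipschitz:
  assumes "\<And>x y. \<bar>f x - f y\<bar> \<le> L * \<bar>x - y\<bar>"
  shows "\<bar>fdiff \<delta> f x - fdiff \<delta> f y\<bar> \<le> (2 * L) * \<bar>x - y\<bar>"
  using assms[of "x + \<delta>" "y + \<delta>"] assms[of x y] by (simp add: fdiff_def)

lemma mlp_approx_iterated_fdiff:
  fixes u :: "'a::euclidean_space \<Rightarrow> real" and \<sigma> :: "real \<Rightarrow> real"
  assumes L: "\<And>x y. \<bar>\<sigma> x - \<sigma> y\<bar> \<le> L * \<bar>x - y\<bar>"
    and B: "\<And>z. z \<in> K \<Longrightarrow> \<bar>u z\<bar> \<le> B" "0 \<le> B"
    and app: "\<And>s b. mlp_approx \<sigma> K (\<lambda>z. \<sigma> (s * u z + b))"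
  shows "mlp_approx \<sigma> K (\<lambda>z. u z ^ i * (fdiff \<delta> ^^ i) \<sigma> (s * u z + b))"
proof -
  have lip: "\<exists>L. \<forall>x y. \<bar>(fdiff \<delta> ^^ i) \<sigma> x - (fdiff \<delta> ^^ i) \<sigma> y\<bar> \<le> L * \<bar>x - y\<bar>" for i
  proof (induction i)
    case 0
    then show ?case using L by auto
  next
    case (Suc i)
    then show ?case unfolding funpow.simps o_def using fdiff_lipschitz by blast
  qed
  show ?thesis
  proof (induction i arbitrary: s b)
    case 0
    then show ?case using app by simp
  next
    case (Suc i)
    obtain L' where "\<And>x y. \<bar>(fdiff \<delta> ^^ i) \<sigma> x - (fdiff \<delta> ^^ i) \<sigma> y\<bar> \<le> L' * \<bar>x - y\<bar>"
      using lip by blast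
    from mlp_approx_fdiff[OF this B Suc] show ?case by simp
  qed
qed

lemma mlp_approx_power:
  fixes \<sigma> :: "real \<Rightarrow> real" and v :: "'a::euclidean_space"
  assumes L: "\<And>x y. \<bar>\<sigma> x - \<sigma> y\<bar> \<le> L * \<bar>x - y\<bar>"
    and nonpoly: "\<not> (\<exists>p. \<forall>x. \<sigma> x = poly p x)" and "bounded K"
  shows "mlp_approx \<sigma> K (\<lambda>z. (v \<bullet> z) ^ i)"
proof -
  have "L-lipschitz_on UNIV \<sigma>"
    using L order_trans[OF abs_ge_zero L[of 1 0]] by (intro lipschitz_onI) (auto simp: dist_real_def)
  then have "continuous_on UNIV \<sigma>" by (rule lipschitz_on_continuous_on)
  \<comment> \<open>Non-polynomiality enters here: if all differences of order \<open>i\<close>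
    vanished, \<open>\<sigma>\<close> would be a polynomial.\<close>
  then obtain \<delta> b where nz: "(fdiff \<delta> ^^ i) \<sigma> b \<noteq> 0"
    using Frechet_polynomial[of \<sigma> i] nonpoly by metis
  obtain R where R: "\<And>z. z \<in> K \<Longrightarrow> norm z \<le> R" "0 < R"
    using \<open>bounded K\<close> unfolding bounded_pos by blast
  \<comment> \<open>Scale 0 freezes the difference at its nonzero value at \<open>b\<close>, so
    dividing by it leaves the power.\<close>
  have "mlp_approx \<sigma> K (\<lambda>z. (v \<bullet> z) ^ i * (fdiff \<delta> ^^ i) \<sigma> (0 * (v \<bullet> z) + b))"
  proof (rule mlp_approx_iterated_fdiff[OF L])
    show "\<bar>v \<bullet> z\<bar> \<le> norm v * R" if "z \<in> K" for z
      using Cauchy_Schwarz_ineq2[of v z] R(1)[OF that] by (meson mult_left_mono norm_ge_zero order_trans)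
    show "0 \<le> norm v * R" using R(2) by simp
    show "mlp_approx \<sigma> K (\<lambda>z. \<sigma> (s * (v \<bullet> z) + b))" for s b
      using mlp_approx_is_mlp[OF is_mlp_neuron[of \<sigma> "s *\<^sub>R v" b]] by simp
  qed
  from mlp_approx_cmult[OF this, of "1 / (fdiff \<delta> ^^ i) \<sigma> b"]
  show ?thesis using nz by simp
qed

section \<open>Exponentials of linear forms and the Stone-Weierstrass theorem\<close>

lemma mlp_approx_exp:
  fixes \<sigma> :: "real \<Rightarrow> real" and v :: "'a::euclidean_space"
  assumes L: "\<And>x y. \<bar>\<sigma> x - \<sigma> y\<bar> \<le> L * \<bar>x - y\<bar>"
    and nonpoly: "\<not> (\<exists>p. \<forall>x. \<sigma> x = poly p x)" and "compact K"
  shows "mlp_approx \<sigma> K (\<lambda>z. exp (v \<bullet> z))"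
proof (rule mlp_approx_limit)
  fix e :: real assume "0 < e"
  \<comment> \<open>On this compact range \<open>exp\<close> is a uniform limit of polynomials,
    whose monomials \<open>mlp_approx_power\<close> handles.\<close>
  have "compact ((\<lambda>z. v \<bullet> z) ` K)"
    using \<open>compact K\<close> by (intro compact_continuous_image continuous_intros)
  then obtain p where p: "real_polynomial_function p"
    "\<And>x. x \<in> (\<lambda>z. v \<bullet> z) ` K \<Longrightarrow> \<bar>exp x - p x\<bar> < e"
    using Stone_Weierstrass_real_polynomial_function[of "(\<lambda>z. v \<bullet> z) ` K" exp e] \<open>0 < e\<close>
      continuous_on_exp[OF continuous_on_id] by auto
  obtain a n where a: "p = (\<lambda>x. \<Sum>i\<le>n. a i * x ^ i)"
    using p(1) real_polynomial_function_iff_sum by blast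
  have "mlp_approx \<sigma> K (\<lambda>z. p (v \<bullet> z))"
    unfolding a using \<open>compact K\<close>
    by (intro mlp_approx_sum mlp_approx_cmult mlp_approx_power[OF L nonpoly] compact_imp_bounded)
  then show "\<exists>g. mlp_approx \<sigma> K g \<and> (\<forall>z\<in>K. norm (exp (v \<bullet> z) - g z) \<le> e)"
    using p(2) by (intro exI[of _ "\<lambda>z. p (v \<bullet> z)"]) (auto intro: less_imp_le)
qed

text \<open>The span of the exponentials of linear forms. Multiplying two of them adds the
  exponents, so the span is an algebra; \<open>v = 0\<close> supplies the constants.\<close>

inductive exp_sum :: "('a::euclidean_space \<Rightarrow> real) \<Rightarrow> bool" where
  exp: "exp_sum (\<lambda>z. c * exp (v \<bullet> z))"
| add: "exp_sum f \<Longrightarrow> exp_sum g \<Longrightarrow> exp_sum (\<lambda>z. f z + g z)"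

lemma exp_sum_mult_exp: "exp_sum f \<Longrightarrow> exp_sum (\<lambda>z. f z * (c * exp (v \<bullet> z)))"
proof (induction rule: exp_sum.induct)
  case (exp d w)
  show ?case using exp_sum.exp[of "d * c" "w + v"] by (simp add: inner_add_left exp_add mult_ac)
next
  case (add f g)
  then show ?case using exp_sum.add by (fastforce simp: distrib_right)
qed

lemma exp_sum_mult: "exp_sum g \<Longrightarrow> exp_sum f \<Longrightarrow> exp_sum (\<lambda>z. f z * g z)"
proof (induction rule: exp_sum.induct)
  case (exp c v)
  then show ?case by (rule exp_sum_mult_exp)
next
  case (add g g')
  then show ?case using exp_sum.add by (fastforce simp: distrib_left)
qed

lemma exp_sum_dense:
  fixes K :: "'a::euclidean_space set" and f :: "'a \<Rightarrow> real"
  assumes "compact K" and "continuous_on K f" and "0 < e"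
  shows "\<exists>g. exp_sum g \<and> (\<forall>x\<in>K. \<bar>f x - g x\<bar> < e)"
proof (rule Stone_Weierstrass_HOL[OF assms(1) _ _ _ _ _ assms(2,3)])
  show "exp_sum (\<lambda>z::'a. c)" for c using exp_sum.exp[of c 0] by simp
  show "continuous_on K f" if "exp_sum f" for f
    using that by (induction rule: exp_sum.induct) (auto intro!: continuous_intros)
  show "exp_sum f \<and> exp_sum g \<Longrightarrow> exp_sum (\<lambda>x. f x + g x)" for f g :: "'a \<Rightarrow> real"
    by (blast intro: exp_sum.add)
  show "exp_sum f \<and> exp_sum g \<Longrightarrow> exp_sum (\<lambda>x. f x * g x)" for f g :: "'a \<Rightarrow> real"
    by (blast intro: exp_sum_mult)
  show "\<exists>f. exp_sum f \<and> f x \<noteq> f y" if "x \<in> K \<and> y \<in> K \<and> x \<noteq> y" for x y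
  proof -
    \<comment> \<open>The two sides differ by the squared norm of \<open>x - y\<close>, and
      \<open>exp\<close> is injective.\<close>
    have "(x - y) \<bullet> x \<noteq> (x - y) \<bullet> y"
      using that by (metis eq_iff_diff_eq_0 inner_diff_right inner_eq_zero_iff)
    then show ?thesis
      using exp_sum.exp[of 1 "x - y"] by (intro exI[of _ "\<lambda>z. 1 * exp ((x - y) \<bullet> z)"]) simp
  qed
qed

lemma mlp_approx_continuous:
  fixes \<sigma> :: "real \<Rightarrow> real" and f :: "'a::euclidean_space \<Rightarrow> 'b::euclidean_space"
  assumes "\<exists>L. L-lipschitz_on UNIV \<sigma>" and nonpoly: "\<not> (\<exists>p. \<forall>x. \<sigma> x = poly p x)"
    and "compact K" and "continuous_on K f"
  shows "mlp_approx \<sigma> K f"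
proof -
  obtain L where L: "\<And>x y. \<bar>\<sigma> x - \<sigma> y\<bar> \<le> L * \<bar>x - y\<bar>"
    using assms(1) by (auto simp: lipschitz_on_def dist_real_def)
  have exp_sum: "mlp_approx \<sigma> K g" if "exp_sum g" for g
    using that
    by (induction rule: exp_sum.induct)
      (auto intro: mlp_approx_add mlp_approx_cmult mlp_approx_exp[OF L nonpoly \<open>compact K\<close>])
  have scalar: "mlp_approx \<sigma> K g" if "continuous_on K g" for g :: "'a \<Rightarrow> real"
  proof (rule mlp_approx_limit)
    fix e :: real assume "0 < e"
    then show "\<exists>p. mlp_approx \<sigma> K p \<and> (\<forall>z\<in>K. norm (g z - p z) \<le> e)"
      using exp_sum_dense[OF \<open>compact K\<close> that \<open>0 < e\<close>] exp_sum by (metis less_imp_le real_norm_def)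
  qed
  \<comment> \<open>Each coordinate is approximated as a scalar function and then placed along its
    basis vector.\<close>
  have "mlp_approx \<sigma> K (\<lambda>z. \<Sum>b\<in>Basis. (f z \<bullet> b) *\<^sub>R b)"
    using assms(4)
    by (intro mlp_approx_sum mlp_approx_linear_image[of "\<lambda>x. x *\<^sub>R _"] scalar continuous_intros)
      (auto intro: bounded_linear.linear bounded_linear_scaleR_left)
  then show ?thesis by (simp add: euclidean_representation)
qed

section \<open>Clipping\<close>

lemma clip_nonexpansive: "norm (clip M v - clip M w) \<le> norm (v - w)"
  unfolding clip_def dist_norm [symmetric]
  by (rule dist_clamps_le_dist_args)

lemma clip_eq_self:
  assumes "norm v \<le> M"
  shows "clip M v = v"
proof -
  have "0 \<le> M" using order_trans[OF norm_ge_zero assms] .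
  have "max (- M) (min M (v $ i)) = v $ i" for i
    using component_le_norm_cart[of v i] assms by linarith
  then show ?thesis by (simp add: vec_eq_iff clip_nth \<open>0 \<le> M\<close>)
qed

text \<open>Nonexpansiveness measured from the fixed point 0. As the bound is the same for every
  \<open>M\<close>, the clipped exact features stay dominated by \<open>g\<close> whichever
  \<open>M\<close> is chosen.\<close>

lemma norm_clip_le_norm: "0 \<le> M \<Longrightarrow> norm (clip M v) \<le> norm (v :: real ^ 'n)"
  using clip_nonexpansive[of M v 0] clip_eq_self[of "0 :: real ^ 'n" M] by simp

text \<open>A crude bound through the l1 norm; what matters is that it is uniform in
  \<open>v\<close>.\<close>

lemma norm_clip_le:
  fixes v :: "real ^ 'n"
  assumes "0 \<le> M"
  shows "norm (clip M v) \<le> real CARD('n) * M"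
proof -
  have "norm (clip M v) \<le> (\<Sum>i\<in>UNIV. \<bar>clip M v $ i\<bar>)" by (rule norm_le_l1_cart)
  also have "\<dots> \<le> (\<Sum>i\<in>(UNIV :: 'n set). M)"
    using assms by (intro sum_mono) (auto simp: clip_nth)
  finally show ?thesis by simp
qed

lemma continuous_clip: "continuous_on S (clip M)"
  by (rule lipschitz_on_continuous_on[of 1])
    (auto intro!: lipschitz_onI simp: dist_norm clip_nonexpansive)

section \<open>Tail integrals, continuity of the profile and pointwise errors\<close>

lemma integral_tail_small:
  fixes \<mu> :: "'a::real_normed_vector measure" and g :: "'a \<Rightarrow> real"
  assumes [measurable_cong]: "sets \<mu> = sets borel" and int: "integrable \<mu> g" and "0 < \<delta>"
  obtains R where "R0 \<le> R" "(\<integral>\<omega>. g \<omega> * indicator {\<omega>. R < norm \<omega>} \<omega> \<partial>\<mu>) \<le> \<delta>"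
proof -
  let ?s = "\<lambda>n \<omega>. g \<omega> * indicator {\<omega>. real n < norm \<omega>} \<omega>"
  have [measurable]: "g \<in> borel_measurable \<mu>" using int by simp
  \<comment> \<open>Dominated convergence: for each \<open>\<omega>\<close> the indicator is 0 once
    \<open>n\<close> reaches its norm.\<close>
  have "(\<lambda>n. \<integral>\<omega>. ?s n \<omega> \<partial>\<mu>) \<longlonglongrightarrow> (\<integral>\<omega>. 0 \<partial>\<mu>)"
  proof (rule integral_dominated_convergence)
    show "integrable \<mu> (\<lambda>\<omega>. \<bar>g \<omega>\<bar>)" using int by simp
    show "AE \<omega> in \<mu>. (\<lambda>n. ?s n \<omega>) \<longlonglongrightarrow> 0"
    proof (rule AE_I2)
      fix \<omega>
      have "\<forall>\<^sub>F n in sequentially. ?s n \<omega> = 0"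
        using eventually_ge_at_top[of "nat \<lceil>norm \<omega>\<rceil>"]
        by eventually_elim (simp add: indicator_def nat_le_iff ceiling_le_iff)
      then show "(\<lambda>n. ?s n \<omega>) \<longlonglongrightarrow> 0" by (rule tendsto_eventually)
    qed
    show "AE \<omega> in \<mu>. norm (?s n \<omega>) \<le> \<bar>g \<omega>\<bar>" for n
      by (rule AE_I2) (simp add: indicator_def)
  qed measurable
  then have "(\<lambda>n. \<integral>\<omega>. ?s n \<omega> \<partial>\<mu>) \<longlonglongrightarrow> 0" by simp
  then have "\<forall>\<^sub>F n in sequentially. (\<integral>\<omega>. ?s n \<omega> \<partial>\<mu>) < \<delta>"
    using \<open>0 < \<delta>\<close> by (rule order_tendstoD)
  moreover have "\<forall>\<^sub>F n in sequentially. R0 \<le> real n"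
    using filterlim_real_sequentially by (auto simp: filterlim_at_top)
  ultimately have "\<forall>\<^sub>F n in sequentially. (\<integral>\<omega>. ?s n \<omega> \<partial>\<mu>) < \<delta> \<and> R0 \<le> real n"
    by (rule eventually_conj)
  then obtain n where "(\<integral>\<omega>. ?s n \<omega> \<partial>\<mu>) < \<delta>" "R0 \<le> real n"
    using eventually_happens'[OF sequentially_bot] by blast
  then show ?thesis by (intro that[of "real n"]) auto
qed

text \<open>Fix \<open>x1 \<noteq> 0\<close> with \<open>h x1 \<noteq> 0\<close>. Every
  \<open>t\<close> is the inner product of \<open>x1\<close> with
  \<open>(t / (x1 \<bullet> x1)) *\<^sub>R x1\<close>, so \<open>\<psi> t\<close> is a value of the
  jointly continuous feature map divided by \<open>h x1\<close>.\<close>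

lemma ridge_profile_continuous:
  fixes h :: "'a::euclidean_space \<Rightarrow> real" and \<psi> :: "real \<Rightarrow> 'b::real_normed_vector"
  assumes h: "continuous_on UNIV h" and "h x0 \<noteq> 0"
    and \<phi>: "continuous_on UNIV (\<lambda>(\<omega>, x). h x *\<^sub>R \<psi> (\<omega> \<bullet> x))"
  shows "continuous_on UNIV \<psi>"
proof -
  \<comment> \<open>This open set contains \<open>x0\<close> and is not the singleton of 0, hence it
    has a nonzero element.\<close>
  have "open {x. h x \<noteq> 0}"
    using open_Collect_neq[OF h continuous_on_const] by simp
  then have "{x. h x \<noteq> 0} \<noteq> {0}" using not_open_singleton by metis
  then obtain x1 where x1: "h x1 \<noteq> 0" "x1 \<noteq> 0" using \<open>h x0 \<noteq> 0\<close> by auto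
  have eq: "\<psi> = (\<lambda>t. (1 / h x1) *\<^sub>R
      (case ((t / (x1 \<bullet> x1)) *\<^sub>R x1, x1) of (\<omega>, x) \<Rightarrow> h x *\<^sub>R \<psi> (\<omega> \<bullet> x)))"
    using x1 by auto
  show ?thesis
    using x1(2)
    by (subst eq) (intro continuous_intros continuous_on_compose2[OF \<phi>]; simp)
qed

lemma inner_diff_le:
  fixes a b c d :: "'a::real_inner"
  assumes "norm (a - c) \<le> e" "norm (b - d) \<le> e" "norm b \<le> B" "norm c \<le> B"
  shows "\<bar>a \<bullet> b - c \<bullet> d\<bar> \<le> 2 * e * B"
proof -
  have e: "0 \<le> e" and "0 \<le> B"
    using order_trans[OF norm_ge_zero assms(1)] order_trans[OF norm_ge_zero assms(3)] .
  have "\<bar>a \<bullet> b - c \<bullet> d\<bar> = \<bar>(a - c) \<bullet> b + c \<bullet> (b - d)\<bar>" by (simp add: algebra_simps)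
  also have "\<dots> \<le> norm (a - c) * norm b + norm c * norm (b - d)"
    using Cauchy_Schwarz_ineq2[of "a - c" b] Cauchy_Schwarz_ineq2[of c "b - d"] by linarith
  also have "\<dots> \<le> e * B + B * e"
    using assms e \<open>0 \<le> B\<close> by (intro add_mono mult_mono) auto
  finally show ?thesis by (simp add: mult_ac)
qed

text \<open>Cauchy-Schwarz, then the inequality of arithmetic and geometric means.\<close>

lemma abs_inner_le_common_bound:
  fixes a b :: "'a::real_inner"
  assumes "(norm a)\<^sup>2 \<le> C" "(norm b)\<^sup>2 \<le> C"
  shows "\<bar>a \<bullet> b\<bar> \<le> C"
  using Cauchy_Schwarz_ineq2[of a b] sum_squares_bound[of "norm a" "norm b"] assms by linarith

text \<open>
  Used with \<open>r\<close> the norm of \<open>\<omega>\<close>, \<open>c\<close> and \<open>d\<close> the clipped versions of the exact features \<open>a\<close> and \<open>b\<close>,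
  and \<open>a'\<close> and \<open>b'\<close> the network features.
\<close>
lemma feature_product_error:
  fixes a b a' b' c d :: "'a::real_inner"
  assumes g: "(norm a)\<^sup>2 \<le> g" "(norm b)\<^sup>2 \<le> g" "(norm c)\<^sup>2 \<le> g" "(norm d)\<^sup>2 \<le> g"
    and B: "norm c \<le> B" "norm d \<le> B" "norm a' \<le> B" "norm b' \<le> B" and "0 \<le> e"
    and clip: "r \<le> R \<Longrightarrow> c = a" "r \<le> R \<Longrightarrow> d = b"
    and near: "r \<le> R' \<Longrightarrow> norm (a' - c) \<le> e" "r \<le> R' \<Longrightarrow> norm (b' - d) \<le> e"
    and "R \<le> (R' :: real)"
  shows "\<bar>a \<bullet> b - a' \<bullet> b'\<bar> \<le> 2 * e * B + 2 * e\<^sup>2 +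
    3 * (g * indicator {r. R < r} r) + B\<^sup>2 * indicator {r. R' < r} r"
proof -
  have g0: "0 \<le> g" and B0: "0 \<le> B"
    using order_trans[OF zero_le_power2 g(1)] order_trans[OF norm_ge_zero B(1)] .
  have ab: "\<bar>a \<bullet> b\<bar> \<le> g" using g by (intro abs_inner_le_common_bound)
  consider "r \<le> R" | "R < r" "r \<le> R'" | "R' < r" by linarith
  then show ?thesis
  proof cases
    case 1
    \<comment> \<open>Clipping is inactive here, so the network features are \<open>e\<close>-close
      to the exact ones.\<close>
    have "\<bar>a \<bullet> b - a' \<bullet> b'\<bar> \<le> 2 * e * B"
    proof (rule inner_diff_le)
      have "r \<le> R'" using 1 \<open>R \<le> R'\<close> by simp
      then show "norm (a - a') \<le> e" "norm (b - b') \<le> e"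
        using near clip[OF 1] by (simp_all add: norm_minus_commute)
      show "norm b \<le> B" "norm a' \<le> B" using B clip(2)[OF 1] by simp_all
    qed
    then show ?thesis using 1 \<open>R \<le> R'\<close> by (simp add: add_increasing2)
  next
    case 2
    \<comment> \<open>The network features are \<open>e\<close>-close to the clipped ones, whose
      squared norms are at most \<open>g\<close>. Their product thus costs
      \<open>2 * g + 2 * e\<^sup>2\<close> and the exact product \<open>g\<close>, whence the factor
      3.\<close>
    have sq: "(norm x)\<^sup>2 \<le> 2 * g + 2 * e\<^sup>2" if "norm (x - y) \<le> e" "(norm y)\<^sup>2 \<le> g" for x y :: 'a
    proof -
      have "norm x \<le> norm y + e" using norm_triangle_ineq[of "x - y" y] that(1) by simp
      then have "(norm x)\<^sup>2 \<le> (norm y + e)\<^sup>2" by (intro power_mono) auto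
      also have "\<dots> \<le> 2 * (norm y)\<^sup>2 + 2 * e\<^sup>2"
        using sum_squares_bound[of "norm y" e] by (simp add: power2_sum)
      finally show ?thesis using that(2) by linarith
    qed
    have "\<bar>a' \<bullet> b'\<bar> \<le> 2 * g + 2 * e\<^sup>2"
      by (intro abs_inner_le_common_bound sq[OF near(1)] sq[OF near(2)] g 2)
    moreover have "0 \<le> 2 * e * B" using \<open>0 \<le> e\<close> B0 by simp
    ultimately have "\<bar>a \<bullet> b - a' \<bullet> b'\<bar> \<le> 2 * e * B + 2 * e\<^sup>2 + 3 * g" using ab by linarith
    with 2 show ?thesis by simp
  next
    case 3
    \<comment> \<open>No closeness is available this far out; the network product is controlled by
      \<open>B\<close> alone, the exact one still by \<open>g\<close>.\<close>
    have "\<bar>a' \<bullet> b'\<bar> \<le> B\<^sup>2"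
      using B by (intro abs_inner_le_common_bound power_mono) auto
    moreover have "0 \<le> 2 * e * B + 2 * e\<^sup>2" using \<open>0 \<le> e\<close> B0 by simp
    ultimately have "\<bar>a \<bullet> b - a' \<bullet> b'\<bar> \<le> 2 * e * B + 2 * e\<^sup>2 + 3 * g + B\<^sup>2"
      using ab g0 by linarith
    moreover have "R < r" using 3 \<open>R \<le> R'\<close> by simp
    ultimately show ?thesis using 3 by simp
  qed
qed

section \<open>Approximation of the kernel\<close>

theorem proposition4:
  fixes K :: "(real ^ 'd) set"
    and k :: "real ^ 'd \<Rightarrow> real ^ 'd \<Rightarrow> real"
    and h :: "real ^ 'd \<Rightarrow> real"
    and k' :: "real ^ 'd \<Rightarrow> real"
    and \<psi> :: "real \<Rightarrow> real ^ 'D"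
    and \<phi> :: "real ^ 'd \<Rightarrow> real ^ 'd \<Rightarrow> real ^ 'D"
    and g :: "real ^ 'd \<Rightarrow> real"
    and \<sigma> :: "real \<Rightarrow> real"
    and \<epsilon> :: real
  assumes "compact K"
    and "pos_def_kernel k"
    and "\<And>x y. k x y = h x * k' (x - y) * h y"
    and "\<And>x y. has_bochner_integral std_gaussian (\<lambda>\<omega>. \<phi> \<omega> x \<bullet> \<phi> \<omega> y) (k x y)"
    and "\<And>\<omega> x. \<phi> \<omega> x = h x *\<^sub>R \<psi> (\<omega> \<bullet> x)"
    and "continuous_on UNIV h"
    and "continuous_on UNIV (\<lambda>(\<omega>, x). \<phi> \<omega> x)"
    and "\<And>\<omega>. bdd_above ((\<lambda>x. (norm (\<phi> \<omega> x))\<^sup>2) ` K)"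
    and "\<And>\<omega>. g \<omega> = (SUP x\<in>K. (norm (\<phi> \<omega> x))\<^sup>2)"
    and "integrable std_gaussian g"
    and "\<exists>L. L-lipschitz_on UNIV \<sigma>"
    and "\<not> (\<exists>p. \<forall>x. \<sigma> x = poly p x)"
    and "0 < \<epsilon>"
  shows "\<exists>M>0. \<exists>(h_NN :: real ^ 'd \<Rightarrow> real) (\<psi>_NN :: real \<Rightarrow> real ^ 'D).
           is_mlp \<sigma> h_NN \<and> is_mlp \<sigma> \<psi>_NN \<and>
           (let \<phi>_NN = (\<lambda>\<omega> x. h_NN x *\<^sub>R clip M (\<psi>_NN (\<omega> \<bullet> x)));
                k_NN = (\<lambda>x y. \<integral>\<omega>. \<phi>_NN \<omega> x \<bullet> \<phi>_NN \<omega> y \<partial>std_gaussian)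
            in \<forall>x\<in>K. \<forall>y\<in>K. \<bar>k x y - k_NN x y\<bar> \<le> \<epsilon>)"
proof (cases "K = {} \<or> (\<forall>x. h x = 0)")
  case True
  \<comment> \<open>Either there is no point to check or \<open>k\<close> vanishes identically, so
    zero networks suffice.\<close>
  have "is_mlp \<sigma> (\<lambda>z::real ^ 'd. 0::real)" "is_mlp \<sigma> (\<lambda>t::real. 0::real ^ 'D)"
    by (rule is_mlp_zero)+
  then show ?thesis
    using True assms(3) \<open>0 < \<epsilon>\<close>
    by (intro exI[of _ 1] conjI exI[of _ "\<lambda>z. 0"]) (auto simp: Let_def)
next
  case False
  then obtain x0 where "h x0 \<noteq> 0" by blast
  interpret G: prob_space "std_gaussian :: (real ^ 'd) measure"
    by (rule prob_space_std_gaussian)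
  have \<phi>_eq: "\<phi> = (\<lambda>\<omega> x. h x *\<^sub>R \<psi> (\<omega> \<bullet> x))"
    using assms(5) by (simp add: fun_eq_iff)
  have \<psi>: "continuous_on UNIV \<psi>"
    using ridge_profile_continuous[OF assms(6) \<open>h x0 \<noteq> 0\<close>] assms(7) unfolding \<phi>_eq by blast
  have \<sigma>: "continuous_on UNIV \<sigma>"
    using assms(11) lipschitz_on_continuous_on by blast
  have g: "(norm (h x *\<^sub>R \<psi> (\<omega> \<bullet> x)))\<^sup>2 \<le> g \<omega>" if "x \<in> K" for \<omega> x
    unfolding assms(9) using that assms(8)[of \<omega>] unfolding \<phi>_eq by (intro cSUP_upper)
  obtain r where r: "0 < r" "\<And>x. x \<in> K \<Longrightarrow> norm x \<le> r"
    using compact_imp_bounded[OF \<open>compact K\<close>] unfolding bounded_pos by blast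
  have inner_le: "\<bar>\<omega> \<bullet> x\<bar> \<le> R * r" if "x \<in> K" "norm \<omega> \<le> R" for \<omega> x R
  proof -
    have "\<bar>\<omega> \<bullet> x\<bar> \<le> norm \<omega> * norm x" by (rule Cauchy_Schwarz_ineq2)
    also have "\<dots> \<le> R * r"
      using that r(2)[OF that(1)] order_trans[OF norm_ge_zero that(2)]
      by (intro mult_mono) auto
    finally show ?thesis .
  qed
  have "bounded (h ` K)"
    using \<open>compact K\<close> assms(6)
    by (intro compact_imp_bounded compact_continuous_image) (auto intro: continuous_on_subset)
  then obtain H where H: "0 < H" "\<And>x. x \<in> K \<Longrightarrow> \<bar>h x\<bar> \<le> H"
    unfolding bounded_pos by auto
  \<comment> \<open>The tail of \<open>g\<close> enters the final bound three times, hence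
    contributes at most \<open>\<epsilon> / 4\<close>.\<close>
  obtain R where R: "0 \<le> R"
    "(\<integral>\<omega>. g \<omega> * indicator {\<omega>. R < norm \<omega>} \<omega> \<partial>std_gaussian) \<le> \<epsilon> / 12"
  proof (rule integral_tail_small[OF sets_std_gaussian assms(10)])
    show "0 < \<epsilon> / 12" using \<open>0 < \<epsilon>\<close> by simp
  qed
  have "bounded (\<psi> ` {- (R * r)..R * r})"
    using \<psi> by (intro compact_imp_bounded compact_continuous_image) (auto intro: continuous_on_subset)
  then obtain M where M: "0 < M" "\<And>t. \<bar>t\<bar> \<le> R * r \<Longrightarrow> norm (\<psi> t) \<le> M"
    unfolding bounded_pos by (auto simp: abs_le_iff)
  \<comment> \<open>Bounds both the clipped exact features and the network features;
    \<open>H + 1\<close> allows for \<open>h_NN\<close> being within 1 of \<open>h\<close>.\<close>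
  define B where "B = (H + 1) * (real CARD('D) * M)"
  have "0 < B" using H(1) M(1) by (simp add: B_def)
  \<comment> \<open>A Gaussian tail probability; multiplied by \<open>B\<^sup>2\<close> it
    contributes at most \<open>\<epsilon> / 4\<close>.\<close>
  obtain R' where R': "R \<le> R'"
    "(\<integral>\<omega>. 1 * indicator {\<omega>. R' < norm \<omega>} \<omega> \<partial>(std_gaussian :: (real ^ 'd) measure)) \<le> \<epsilon> / (4 * B\<^sup>2)"
  proof (rule integral_tail_small[OF sets_std_gaussian G.integrable_const])
    show "0 < \<epsilon> / (4 * B\<^sup>2)" using \<open>0 < \<epsilon>\<close> \<open>0 < B\<close> by simp
  qed
  \<comment> \<open>As \<open>e \<le> 1\<close>, the sum \<open>2 * e * B + 2 * e\<^sup>2\<close> is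
    at most \<open>2 * (e * (B + 1))\<close>, hence at most \<open>\<epsilon> / 4\<close>.\<close>
  define e where "e = min 1 (\<epsilon> / 8 / (B + 1))"
  have e: "0 < e" "e \<le> 1" "e * (B + 1) \<le> \<epsilon> / 8"
  proof -
    show "0 < e" "e \<le> 1" using \<open>0 < \<epsilon>\<close> \<open>0 < B\<close> by (auto simp: e_def)
    have "e * (B + 1) \<le> \<epsilon> / 8 / (B + 1) * (B + 1)"
      using \<open>0 < B\<close> by (intro mult_right_mono) (auto simp: e_def)
    also have "\<dots> = \<epsilon> / 8" using \<open>0 < B\<close> by (simp add: field_simps)
    finally show "e * (B + 1) \<le> \<epsilon> / 8" .
  qed
  \<comment> \<open>The accuracy required of both networks: the feature error in \<open>near\<close>
    will be at most \<open>\<eta> * B + H * \<eta>\<close>.\<close>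
  define \<eta> where "\<eta> = min 1 (e / (B + H))"
  have \<eta>: "0 < \<eta>" "\<eta> \<le> 1" "\<eta> * (B + H) \<le> e"
  proof -
    show "0 < \<eta>" "\<eta> \<le> 1" using e(1) \<open>0 < B\<close> H(1) by (auto simp: \<eta>_def)
    have "\<eta> * (B + H) \<le> e / (B + H) * (B + H)"
      using \<open>0 < B\<close> H(1) by (intro mult_right_mono) (auto simp: \<eta>_def)
    then show "\<eta> * (B + H) \<le> e" using \<open>0 < B\<close> H(1) by simp
  qed
  obtain h_NN :: "real ^ 'd \<Rightarrow> real" where h_NN: "is_mlp \<sigma> h_NN" "\<And>x. x \<in> K \<Longrightarrow> \<bar>h x - h_NN x\<bar> \<le> \<eta>"
    using mlp_approx_continuous[OF assms(11,12) \<open>compact K\<close>, of h] assms(6) \<eta>(1)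
    unfolding mlp_approx_def by (metis continuous_on_subset real_norm_def subset_UNIV)
  obtain \<psi>_NN :: "real \<Rightarrow> real ^ 'D" where \<psi>_NN: "is_mlp \<sigma> \<psi>_NN"
    "\<And>t. \<bar>t\<bar> \<le> R' * r \<Longrightarrow> norm (\<psi> t - \<psi>_NN t) \<le> \<eta>"
    using mlp_approx_continuous[OF assms(11,12) compact_Icc, of "- (R' * r)" "R' * r" \<psi>] \<psi> \<eta>(1)
    unfolding mlp_approx_def by (metis abs_le_iff atLeastAtMost_iff continuous_on_subset minus_le_iff subset_UNIV)
  \<comment> \<open>The intermediate features: equal to \<open>\<phi>\<close> up to radius
    \<open>R\<close>, close to \<open>\<phi>_NN\<close> up to radius \<open>R'\<close>, and
    dominated by \<open>g\<close> everywhere.\<close>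
  define \<phi>_M where "\<phi>_M \<omega> x = h x *\<^sub>R clip M (\<psi> (\<omega> \<bullet> x))" for \<omega> x
  define \<phi>_NN where "\<phi>_NN \<omega> x = h_NN x *\<^sub>R clip M (\<psi>_NN (\<omega> \<bullet> x))" for \<omega> x
  have h_NN_le: "\<bar>h_NN x\<bar> \<le> H + 1" if "x \<in> K" for x
    using h_NN(2)[OF that] H(2)[OF that] \<eta>(2) by linarith
  have \<phi>_M_eq: "\<phi>_M \<omega> x = \<phi> \<omega> x" if "x \<in> K" "norm \<omega> \<le> R" for \<omega> x
    using M(2)[OF inner_le[OF that]] by (simp add: \<phi>_M_def \<phi>_eq clip_eq_self)
  have \<phi>_M_g: "(norm (\<phi>_M \<omega> x))\<^sup>2 \<le> g \<omega>" if "x \<in> K" for \<omega> x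
  proof (rule order_trans[OF power_mono g[OF that]])
    show "norm (\<phi>_M \<omega> x) \<le> norm (h x *\<^sub>R \<psi> (\<omega> \<bullet> x))"
      using M(1) by (simp add: \<phi>_M_def mult_left_mono norm_clip_le_norm)
  qed simp
  have \<phi>_M_B: "norm (\<phi>_M \<omega> x) \<le> B" if "x \<in> K" for \<omega> x
    unfolding \<phi>_M_def B_def norm_scaleR
    using H(2)[OF that] M(1) H(1) by (intro mult_mono norm_clip_le) auto
  have \<phi>_NN_B: "norm (\<phi>_NN \<omega> x) \<le> B" if "x \<in> K" for \<omega> x
    unfolding \<phi>_NN_def B_def norm_scaleR
    using h_NN_le[OF that] M(1) H(1) by (intro mult_mono norm_clip_le) auto
  have near: "norm (\<phi>_NN \<omega> x - \<phi>_M \<omega> x) \<le> e" if "x \<in> K" "norm \<omega> \<le> R'" for \<omega> x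
  proof -
    let ?t = "\<omega> \<bullet> x"
    have 1: "norm (clip M (\<psi>_NN ?t)) \<le> B"
    proof -
      have "norm (clip M (\<psi>_NN ?t)) \<le> 1 * (real CARD('D) * M)"
        using norm_clip_le[of M "\<psi>_NN ?t"] M(1) by simp
      also have "\<dots> \<le> B" unfolding B_def using H(1) M(1) by (intro mult_right_mono) auto
      finally show ?thesis .
    qed
    have 2: "norm (clip M (\<psi>_NN ?t) - clip M (\<psi> ?t)) \<le> \<eta>"
      using clip_nonexpansive[of M "\<psi>_NN ?t" "\<psi> ?t"] \<psi>_NN(2)[OF inner_le[OF that]]
      by (simp add: norm_minus_commute)
    \<comment> \<open>The error of \<open>h_NN\<close> is paired with the clipped network, which is
      bounded by \<open>B\<close>, and the error of \<open>\<psi>_NN\<close> with \<open>h\<close>,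
      bounded by \<open>H\<close>.\<close>
    have "\<phi>_NN \<omega> x - \<phi>_M \<omega> x = (h_NN x - h x) *\<^sub>R clip M (\<psi>_NN ?t)
        + h x *\<^sub>R (clip M (\<psi>_NN ?t) - clip M (\<psi> ?t))"
      by (simp add: \<phi>_NN_def \<phi>_M_def algebra_simps)
    then have "norm (\<phi>_NN \<omega> x - \<phi>_M \<omega> x) \<le> \<bar>h_NN x - h x\<bar> * norm (clip M (\<psi>_NN ?t))
        + \<bar>h x\<bar> * norm (clip M (\<psi>_NN ?t) - clip M (\<psi> ?t))"
      by (metis norm_triangle_ineq norm_scaleR)
    also have "\<dots> \<le> \<eta> * B + H * \<eta>"
      using h_NN(2)[OF that(1)] H 1 2 that(1) \<eta>(1)
      by (intro add_mono mult_mono) (auto simp: abs_minus_commute)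
    also have "\<dots> \<le> e" using \<eta>(3) by (simp add: algebra_simps)
    finally show ?thesis .
  qed
  have \<phi>_NN_int: "integrable std_gaussian (\<lambda>\<omega>. \<phi>_NN \<omega> x \<bullet> \<phi>_NN \<omega> y)" if "x \<in> K" "y \<in> K" for x y
  proof (rule G.integrable_const_bound[of _ "B * B"])
    show "AE \<omega> in std_gaussian. norm (\<phi>_NN \<omega> x \<bullet> \<phi>_NN \<omega> y) \<le> B * B"
    proof (rule AE_I2)
      fix \<omega>
      have "\<bar>\<phi>_NN \<omega> x \<bullet> \<phi>_NN \<omega> y\<bar> \<le> norm (\<phi>_NN \<omega> x) * norm (\<phi>_NN \<omega> y)"
        by (rule Cauchy_Schwarz_ineq2)
      also have "\<dots> \<le> B * B" using \<phi>_NN_B that \<open>0 < B\<close> by (intro mult_mono) auto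
      finally show "norm (\<phi>_NN \<omega> x \<bullet> \<phi>_NN \<omega> y) \<le> B * B" by simp
    qed
    have "continuous_on UNIV (\<lambda>\<omega>. \<phi>_NN \<omega> x)" for x
      unfolding \<phi>_NN_def
      by (intro continuous_intros continuous_on_compose2[OF continuous_clip]
          continuous_on_compose2[OF continuous_is_mlp[OF \<sigma> \<psi>_NN(1)]]) auto
    then have "(\<lambda>\<omega>. \<phi>_NN \<omega> x \<bullet> \<phi>_NN \<omega> y) \<in> borel_measurable borel"
      by (intro borel_measurable_continuous_onI continuous_intros)
    then show "(\<lambda>\<omega>. \<phi>_NN \<omega> x \<bullet> \<phi>_NN \<omega> y) \<in> borel_measurable std_gaussian"
      by (simp cong: measurable_cong_sets)
  qed
  \<comment> \<open>The bound of \<open>feature_product_error\<close> at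
    \<open>r = norm \<omega>\<close>. It does not depend on \<open>x\<close> and \<open>y\<close>,
    which makes the estimate uniform on \<open>K\<close>.\<close>
  define D where "D \<omega> = 2 * e * B + 2 * e\<^sup>2 + 3 * (g \<omega> * indicator {\<omega>. R < norm \<omega>} \<omega>)
    + B\<^sup>2 * (1 * indicator {\<omega>. R' < norm \<omega>} \<omega>)" for \<omega> :: "real ^ 'd"
  have int_g: "integrable std_gaussian (\<lambda>\<omega>. g \<omega> * indicator {\<omega>. R < norm \<omega>} \<omega>)"
    using integrable_mult_indicator[OF _ assms(10), of "{\<omega>. R < norm \<omega>}"]
    by (simp add: mult.commute)
  have int_1: "integrable (std_gaussian :: (real ^ 'd) measure)
      (\<lambda>\<omega>. 1 * indicator {\<omega>. R' < norm \<omega>} \<omega> :: real)"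
    using integrable_mult_indicator[OF _ G.integrable_const, of "{\<omega>. R' < norm \<omega>}" "1 :: real"]
    by (simp add: mult.commute)
  have D_int: "integrable std_gaussian D"
    unfolding D_def by (intro Bochner_Integration.integrable_add integrable_mult_right int_g int_1)
      auto
  have D_le: "(\<integral>\<omega>. D \<omega> \<partial>std_gaussian) \<le> \<epsilon>"
  proof -
    have "(\<integral>\<omega>. D \<omega> \<partial>std_gaussian) = 2 * e * B + 2 * e\<^sup>2
        + 3 * (\<integral>\<omega>. g \<omega> * indicator {\<omega>. R < norm \<omega>} \<omega> \<partial>std_gaussian)
        + B\<^sup>2 * (\<integral>\<omega>. 1 * indicator {\<omega>. R' < norm \<omega>} \<omega> \<partial>(std_gaussian :: (real ^ 'd) measure))"
      unfolding D_def using int_g int_1 G.prob_space by (simp del: mult_1)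
    also have "\<dots> \<le> 2 * e * B + 2 * e\<^sup>2 + 3 * (\<epsilon> / 12) + B\<^sup>2 * (\<epsilon> / (4 * B\<^sup>2))"
      using R(2) mult_left_mono[OF R'(2) zero_le_power2[of B]] by linarith
    also have "\<dots> = 2 * e * B + 2 * e\<^sup>2 + \<epsilon> / 2" using \<open>0 < B\<close> by (simp add: field_simps)
    also have "\<dots> \<le> 2 * (e * (B + 1)) + \<epsilon> / 2"
      using mult_left_mono[OF e(2), of e] e(1) by (simp add: power2_eq_square algebra_simps)
    also have "\<dots> \<le> \<epsilon>" using e(3) \<open>0 < \<epsilon>\<close> by simp
    finally show ?thesis .
  qed
  have "\<bar>k x y - (\<integral>\<omega>. \<phi>_NN \<omega> x \<bullet> \<phi>_NN \<omega> y \<partial>std_gaussian)\<bar> \<le> \<epsilon>"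
    if "x \<in> K" "y \<in> K" for x y
  proof -
    have int: "integrable std_gaussian (\<lambda>\<omega>. \<phi> \<omega> x \<bullet> \<phi> \<omega> y)"
      and k: "k x y = (\<integral>\<omega>. \<phi> \<omega> x \<bullet> \<phi> \<omega> y \<partial>std_gaussian)"
      using assms(4)[of x y] by (auto simp: has_bochner_integral_iff)
    have pointwise: "\<bar>\<phi> \<omega> x \<bullet> \<phi> \<omega> y - \<phi>_NN \<omega> x \<bullet> \<phi>_NN \<omega> y\<bar> \<le> D \<omega>" for \<omega>
    proof -
      have "\<bar>\<phi> \<omega> x \<bullet> \<phi> \<omega> y - \<phi>_NN \<omega> x \<bullet> \<phi>_NN \<omega> y\<bar> \<le> 2 * e * B + 2 * e\<^sup>2 +
          3 * (g \<omega> * indicator {r. R < r} (norm \<omega>)) + B\<^sup>2 * indicator {r. R' < r} (norm \<omega>)"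
        using g that unfolding \<phi>_eq [symmetric]
        by (intro feature_product_error[where c = "\<phi>_M \<omega> x" and d = "\<phi>_M \<omega> y"]
            \<phi>_M_g \<phi>_M_B \<phi>_NN_B \<phi>_M_eq near less_imp_le[OF e(1)] R'(1)) (auto simp: \<phi>_eq)
      then show ?thesis by (simp add: D_def indicator_def)
    qed
    have "\<bar>k x y - (\<integral>\<omega>. \<phi>_NN \<omega> x \<bullet> \<phi>_NN \<omega> y \<partial>std_gaussian)\<bar>
        = \<bar>\<integral>\<omega>. \<phi> \<omega> x \<bullet> \<phi> \<omega> y - \<phi>_NN \<omega> x \<bullet> \<phi>_NN \<omega> y \<partial>std_gaussian\<bar>"
      using int \<phi>_NN_int[OF that] by (simp add: k)
    also have "\<dots> \<le> (\<integral>\<omega>. \<bar>\<phi> \<omega> x \<bullet> \<phi> \<omega> y - \<phi>_NN \<omega> x \<bullet> \<phi>_NN \<omega> y\<bar> \<partial>std_gaussian)"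
      by (rule integral_abs_bound)
    also have "\<dots> \<le> (\<integral>\<omega>. D \<omega> \<partial>std_gaussian)"
      using int \<phi>_NN_int[OF that] D_int pointwise by (intro integral_mono) auto
    also note D_le
    finally show ?thesis .
  qed
  then show ?thesis
    using M(1) h_NN(1) \<psi>_NN(1) unfolding \<phi>_NN_def Let_def by blast
qed

end
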